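(* Let $n$ be a positive integer. Let either $(\lambda_0,\ldots,\lambda_n)$ be a partition and $k\ge\lambda_0$ an integer, or $(\lambda_0,\ldots,\lambda_n)$ be a half-partition and $k\ge\lambda_0$ a half-integer. Then $$2\prod_{i=1}^n\bigl(x_i^{1/2}+\bar{x}_i^{1/2}\bigr)\; s_{(k+\lambda_1,\ldots,k+\lambda_n,k-\lambda_n,\ldots,k-\lambda_0)}(x_1,\ldots,x_n,\bar{x}_1,\ldots,\bar{x}_n,1)$$ $$=\mathit{so}^{\mathrm{odd}}_{(\lambda_1,\ldots,\lambda_n)}(x_1,\ldots,x_n)\; o^{\mathrm{even}}_{(\lambda_0+1/2,\ldots,\lambda_n+1/2)}(x_1,\ldots,x_n,1)$$ and, for each of the two choices of sign in $\pm$, $$2\prod_{i=1}^n\bigl(x_i^{1/2}+\bar{x}_i^{1/2}\bigr)\; s_{(k+\lambda_0,\ldots,k+\lambda_{n-1},k\pm\lambda_n,k-\lambda_{n-1},\ldots,k-\lambda_0)}(x_1,\ldots,x_n,\bar{x}_1,\ldots,\bar{x}_n,1)$$ $$=(1+\delta_{\lambda_n,0})\;\mathit{so}^{\mathrm{odd}}_{(\lambda_0+1/2,\ldots,\lambda_{n-1}+1/2)}(x_1,\ldots,x_n)\; o^{\mathrm{even}}_{(\lambda_0,\ldots,\lambda_n)}(x_1,\ldots,x_n,1).$$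
   Context: A half-integer is an odd integer divided by 2. A partition (respectively half-partition) is a tuple whose entries are all nonnegative integers (respectively all positive half-integers) in weakly decreasing order; zero entries of a partition are kept explicitly. Here the tuple is indexed from $0$, so $\lambda_0\ge\lambda_1\ge\cdots\ge\lambda_n$. The $x_i$ are indeterminates, $\bar{x}=x^{-1}$, and half-integer powers are powers of a formal square root $x_i^{1/2}$, with $\bar{x}_i^{1/2}=(x_i^{1/2})^{-1}$; when a variable is set to $1$, its square root is also $1$. $\delta$ is the Kronecker delta. For a partition $\mu=(\mu_1,\ldots,\mu_N)$, the Schur polynomial is $$s_\mu(y_1,\ldots,y_N)=\frac{\det_{1\le i,j\le N}\bigl(y_i^{\mu_j+N-j}\bigr)}{\prod_{1\le i<j\le N}(y_i-y_j)}.$$ It is a symmetric polynomial in $y_1,\ldots,y_N$, which can be evaluated at arbitrary arguments. For a partition or half-partition $\mu=(\mu_1,\ldots,\mu_N)$, the odd orthogonal character is $$\mathit{so}^{\mathrm{odd}}_\mu(y_1,\ldots,y_N)=\frac{\det_{1\le i,j\le N}\bigl(y_i^{\mu_j+N-j+1/2}-\bar{y}_i^{\mu_j+N-j+1/2}\bigr)}{\prod_{i=1}^N\bigl(y_i^{1/2}-\bar{y}_i^{1/2}\bigr)\prod_{1\le i<j\le N}(y_i+\bar{y}_i-y_j-\bar{y}_j)},$$ and the even orthogonal character is $$o^{\mathrm{even}}_\mu(y_1,\ldots,y_N)=\frac{\det_{1\le i,j\le N}\bigl(y_i^{\mu_j+N-j}+\bar{y}_i^{\mu_j+N-j}\bigr)}{(1+\delta_{\mu_N,0})\prod_{1\le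 i<j\le N}(y_i+\bar{y}_i-y_j-\bar{y}_j)}.$$ In these definitions the entries of $\mu$ are indexed from $1$; a tuple such as $(\lambda_0,\ldots,\lambda_n)$ is used as an index with $N=n+1$ and $\mu_j=\lambda_{j-1}$. *)

theory Defs
  imports
    "HOL-Library.Poly_Mapping"
    "HOL-Computational_Algebra.Fraction_Field"
    "Jordan_Normal_Form.Determinant"
begin

definition half_integer :: "rat \<Rightarrow> bool" where
  "half_integer r \<longleftrightarrow> (\<exists>m::int. odd m \<and> r = of_int m / 2)"

definition is_partition :: "rat list \<Rightarrow> bool" where
  "is_partition \<mu> \<longleftrightarrow> (\<forall>a\<in>set \<mu>. a \<in> \<nat>) \<and> sorted_wrt (\<ge>) \<mu>"

definition is_half_partition :: "rat list \<Rightarrow> bool" where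
  "is_half_partition \<mu> \<longleftrightarrow> (\<forall>a\<in>set \<mu>. half_integer a \<and> 0 < a) \<and> sorted_wrt (\<ge>) \<mu>"

(* For a with 2 * a an integer, half_power t a is the power y^a of y = t^2,
   taken with respect to the square root t of y. *)
definition half_power :: "'a::field \<Rightarrow> rat \<Rightarrow> 'a" where
  "half_power t a = t powi \<lfloor>2 * a\<rfloor>"

(* List positions and matrix indices start at 0, so N - j for 1 \<le> j \<le> N becomes N - Suc j
   for j < N.  The Schur polynomial is applied to the list ys of its arguments and an integral
   index.  The quotient is its value whenever the arguments are pairwise distinct; see
   distinct_schur_args below for the arguments in use. *)
definition schur :: "rat list \<Rightarrow> 'a::field list \<Rightarrow> 'a" where
  "schur \<mu> ys = (let N = length ys in
     det (mat N N (\<lambda>(i, j). ys ! i powi \<lfloor>\<mu> ! j + of_nat (N - Suc j)\<rfloor>))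
     / (\<Prod>j<N. \<Prod>i<j. ys ! i - ys ! j))"

(* In so_odd and o_even the list ts holds the square roots of the arguments:
   the i-th argument is y = (ts ! i)^2. *)
definition orth_denom :: "'a::field list \<Rightarrow> 'a" where
  "orth_denom ts = (\<Prod>j<length ts. \<Prod>i<j.
     (ts ! i)\<^sup>2 + inverse ((ts ! i)\<^sup>2) - (ts ! j)\<^sup>2 - inverse ((ts ! j)\<^sup>2))"

definition so_odd :: "rat list \<Rightarrow> 'a::field list \<Rightarrow> 'a" where
  "so_odd \<mu> ts = (let N = length ts in
     det (mat N N (\<lambda>(i, j).
       half_power (ts ! i) (\<mu> ! j + of_nat (N - Suc j) + 1/2)
       - half_power (inverse (ts ! i)) (\<mu> ! j + of_nat (N - Suc j) + 1/2)))
     / ((\<Prod>i<N. ts ! i - inverse (ts ! i)) * orth_denom ts))"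

definition o_even :: "rat list \<Rightarrow> 'a::field list \<Rightarrow> 'a" where
  "o_even \<mu> ts = (let N = length ts in
     det (mat N N (\<lambda>(i, j).
       half_power (ts ! i) (\<mu> ! j + of_nat (N - Suc j))
       + half_power (inverse (ts ! i)) (\<mu> ! j + of_nat (N - Suc j))))
     / ((1 + of_bool (\<mu> ! (N - 1) = 0)) * orth_denom ts))"

(* The field of fractions of the polynomial ring over the integers in the indeterminates
   sqrt_indet 0, sqrt_indet 1, ...; the variables indet i are the squares of these. *)
type_synonym ratfun = "((nat \<Rightarrow>\<^sub>0 nat) \<Rightarrow>\<^sub>0 int) fract"

definition sqrt_indet :: "nat \<Rightarrow> ratfun" where
  "sqrt_indet i = Fract (Poly_Mapping.single (Poly_Mapping.single i 1) 1) 1"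

definition indet :: "nat \<Rightarrow> ratfun" where
  "indet i = (sqrt_indet i)\<^sup>2"

(* The arguments below are in general position, so that no division by zero occurs. *)

lemma indet_eq: "indet i = Fract (Poly_Mapping.single (Poly_Mapping.single i 2) 1) 1"
  by (simp add: indet_def sqrt_indet_def power2_eq_square Poly_Mapping.mult_single
      numeral_2_eq_2 flip: Poly_Mapping.single_add)

lemma indet_mult: "indet i * indet j =
    Fract (Poly_Mapping.single (Poly_Mapping.single i 2 + Poly_Mapping.single j 2) 1) 1"
  by (simp add: indet_eq Poly_Mapping.mult_single)

lemma single_one_eq_iff:
  "Poly_Mapping.single a (1::int) = Poly_Mapping.single b 1 \<longleftrightarrow> a = b"
  by (metis lookup_single_eq lookup_single_not_eq zero_neq_one)

lemma indet_nonzero: "indet i \<noteq> 0"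
  by (simp add: indet_eq Zero_fract_def eq_fract)

lemma indet_eq_iff: "indet i = indet j \<longleftrightarrow> i = j"
proof -
  have "Poly_Mapping.single i (2::nat) = Poly_Mapping.single j 2 \<longleftrightarrow> i = j"
    by (metis lookup_single_eq lookup_single_not_eq zero_neq_numeral)
  then show ?thesis
    by (simp add: indet_eq eq_fract single_one_eq_iff)
qed

lemma indet_mult_neq_1: "indet i * indet j \<noteq> 1"
proof
  assume "indet i * indet j = 1"
  then have "Poly_Mapping.single (Poly_Mapping.single i 2 + Poly_Mapping.single j 2) (1::int)
      = Poly_Mapping.single (0 :: nat \<Rightarrow>\<^sub>0 nat) 1"
    by (simp add: indet_mult One_fract_def eq_fract)
  then have "Poly_Mapping.single i (2::nat) + Poly_Mapping.single j 2 = 0"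
    by (simp only: single_one_eq_iff)
  then have "Poly_Mapping.lookup (Poly_Mapping.single i (2::nat) + Poly_Mapping.single j 2) i = 0"
    by (simp only: Poly_Mapping.lookup_zero)
  then show False
    by (simp add: Poly_Mapping.lookup_add)
qed

lemma indet_neq_1: "indet i \<noteq> 1"
  using indet_mult_neq_1[of i i] by auto

lemma distinct_schur_args:
  "distinct (map indet [1..<Suc n] @ map (\<lambda>i. inverse (indet i)) [1..<Suc n] @ [1])"
proof -
  have "indet i \<noteq> inverse (indet j)" for i j
    using indet_mult_neq_1[of i j] indet_nonzero[of j] by (metis left_inverse)
  moreover have "inverse (indet i) \<noteq> 1" for i
    using indet_neq_1[of i] by (metis inverse_1 inverse_inverse_eq)
  ultimately show ?thesis
    using indet_neq_1 by (auto simp: distinct_map inj_on_def indet_eq_iff)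
qed

lemma distinct_sum_inverse:
  fixes a b :: "'a::field"
  assumes "a \<noteq> 0" "b \<noteq> 0" "a \<noteq> b" "a * b \<noteq> 1"
  shows "a + inverse a - b - inverse b \<noteq> 0"
proof
  assume "a + inverse a - b - inverse b = 0"
  then have "(a + inverse a - b - inverse b) * (a * b) = 0"
    by simp
  moreover have "(a + inverse a - b - inverse b) * (a * b) = (a - b) * (a * b - 1)"
    using assms(1,2) by (simp add: field_simps)
  ultimately show False
    using assms(3,4) by simp
qed

lemma orth_denom_nonzero: "orth_denom (map sqrt_indet [1..<Suc n] @ [1]) \<noteq> 0"
proof -
  let ?ts = "map sqrt_indet [1..<Suc n] @ [1]"
  have *: "(?ts ! i)\<^sup>2 = indet (Suc i)" if "i < n" for i
    using that by (simp add: nth_append indet_def del: upt_Suc)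
  have **: "(?ts ! n)\<^sup>2 = 1"
    by (simp add: nth_append del: upt_Suc)
  have "(?ts ! i)\<^sup>2 + inverse ((?ts ! i)\<^sup>2) - (?ts ! j)\<^sup>2 - inverse ((?ts ! j)\<^sup>2) \<noteq> 0"
    if "i < j" "j \<le> n" for i j
  proof (rule distinct_sum_inverse)
    have i: "(?ts ! i)\<^sup>2 = indet (Suc i)"
      using that * by simp
    have j: "(?ts ! j)\<^sup>2 = (if j < n then indet (Suc j) else 1)"
      using that * ** by (cases "j = n") auto
    show "(?ts ! i)\<^sup>2 \<noteq> 0" "(?ts ! j)\<^sup>2 \<noteq> 0" "(?ts ! i)\<^sup>2 \<noteq> (?ts ! j)\<^sup>2"
      "(?ts ! i)\<^sup>2 * (?ts ! j)\<^sup>2 \<noteq> 1"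
      unfolding i j using that indet_nonzero indet_neq_1 indet_mult_neq_1 by (auto simp: indet_eq_iff)
  qed
  then show ?thesis
    by (auto simp: orth_denom_def less_Suc_eq_le simp del: upt_Suc)
qed

lemma orth_denom_nonzero': "orth_denom (map sqrt_indet [1..<Suc n]) \<noteq> 0"
proof -
  let ?ts = "map sqrt_indet [1..<Suc n]"
  have "orth_denom (?ts @ [1]) = orth_denom ?ts * (\<Prod>i<n. (?ts ! i)\<^sup>2
      + inverse ((?ts ! i)\<^sup>2) - 1\<^sup>2 - inverse (1\<^sup>2))"
    by (simp add: orth_denom_def nth_append del: upt_Suc)
  then show ?thesis
    using orth_denom_nonzero[of n] by auto
qed

lemma two_ratfun_nonzero: "(2 :: ratfun) \<noteq> 0"
proof
  assume "(2 :: ratfun) = 0"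
  then have "Fract (1 + 1) 1 = (Fract 0 1 :: ratfun)"
    by (simp only: one_add_one[symmetric] One_fract_def Zero_fract_def add_fract) simp
  then have "(1 + 1 :: (nat \<Rightarrow>\<^sub>0 nat) \<Rightarrow>\<^sub>0 int) = 0"
    by (simp add: eq_fract)
  then have "Poly_Mapping.lookup (1 + 1 :: (nat \<Rightarrow>\<^sub>0 nat) \<Rightarrow>\<^sub>0 int) 0 = 0"
    by (simp only: Poly_Mapping.lookup_zero)
  then show False
    by (simp only: Poly_Mapping.lookup_add Poly_Mapping.lookup_one) simp
qed

lemma sqrt_indet_minus_inverse_nonzero: "sqrt_indet i - inverse (sqrt_indet i) \<noteq> 0"
proof -
  have "sqrt_indet i * sqrt_indet i \<noteq> 1" "sqrt_indet i \<noteq> 0"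
    using indet_neq_1[of i] indet_nonzero[of i] by (auto simp: indet_def power2_eq_square)
  then show ?thesis
    by (metis eq_iff_diff_eq_0 right_inverse)
qed

end

theory Submission
  imports Defs
begin

text \<open>After a common power of the arguments is split off (their product is 1, so it does not affect
  the determinant), the Schur numerator has rows indexed by the \<open>x\<^sub>i\<close>, the \<open>1/x\<^sub>i\<close> and 1, and columns
  indexed by exponents that occur in pairs \<open>e, -e\<close>, with one exponent left over. Passing to
  differences of paired columns and to sums of the rows of \<open>x\<^sub>i\<close> and \<open>1/x\<^sub>i\<close> makes this matrix
  block triangular: one block is the odd orthogonal numerator, the other is the even orthogonal
  numerator with its last row, which belongs to the argument 1, halved. The Vandermonde
  denominator factors accordingly, and its sign cancels the sign of the column reversal.\<close>

section \<open>Determinants under column reversal and block triangularisation\<close>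

lemma det_row_scale:
  fixes A :: "nat \<Rightarrow> nat \<Rightarrow> 'a::comm_ring_1"
  shows "det (mat N N (\<lambda>(i, j). f i * A i j)) = (\<Prod>i<N. f i) * det (mat N N (\<lambda>(i, j). A i j))"
  by (simp add: det_def'[of _ N] prod.distrib sum_distrib_left mult_ac lessThan_atLeast0)

text \<open>The 1 of the first row sits in the last column; splitting it off leaves the exchange
  matrix of size one less and a sign \<open>(- 1) ^ m\<close>. The sign of the reversal is kept as a
  product so that it matches the sign of the Vandermonde product literally.\<close>

lemma det_exchange_mat:
  "det (mat m m (\<lambda>(i, j). of_bool (Suc (i + j) = m)) :: 'a::idom mat) = (\<Prod>j<m. (- 1) ^ j)"
proof (induction m)
  case (Suc m)
  let ?J = "\<lambda>m. mat m m (\<lambda>(i, j). of_bool (Suc (i + j) = m)) :: 'a mat"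
  have "?J (Suc m) = four_block_mat (0\<^sub>m 1 m) (1\<^sub>m 1) (?J m) (0\<^sub>m m 1)"
    by (rule eq_matI) auto
  also have "det \<dots> = (- 1) ^ m * det (1\<^sub>m 1 :: 'a mat) * det (?J m)"
    by (rule det_four_block_mat_lower_right_zero_col) auto
  finally show ?case
    using Suc.IH by simp
qed simp

text \<open>With \<open>j = n + p\<close> the source column is \<open>n + (m - 1 - p)\<close>, so
  the last \<open>m\<close> columns are read backwards. This is right multiplication by
  \<open>Q\<close>, the block diagonal matrix of an identity and an exchange matrix.\<close>

lemma det_reverse_last_cols:
  fixes A :: "nat \<Rightarrow> nat \<Rightarrow> 'a::idom"
  shows "det (mat (n + m) (n + m) (\<lambda>(i, j). A i (if j < n then j else 2 * n + m - Suc j)))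
    = (\<Prod>j<m. (- 1) ^ j) * det (mat (n + m) (n + m) (\<lambda>(i, j). A i j))"
proof -
  let ?N = "n + m"
  define J :: "'a mat" where "J = mat m m (\<lambda>(i, j). of_bool (Suc (i + j) = m))"
  define Q where "Q = four_block_mat (1\<^sub>m n) (0\<^sub>m n m) (0\<^sub>m m n) J"
  define B where "B = mat ?N ?N (\<lambda>(i, j). A i j)"
  have J: "J \<in> carrier_mat m m"
    by (simp add: J_def)
  have Q: "Q \<in> carrier_mat ?N ?N"
    using J by (simp add: Q_def)
  have Q_index: "Q $$ (i, j) = of_bool (i = (if j < n then j else 2 * n + m - Suc j))"
    if "i < ?N" "j < ?N" for i j
    using that J by (auto simp: Q_def J_def)
  have "mat ?N ?N (\<lambda>(i, j). A i (if j < n then j else 2 * n + m - Suc j)) = B * Q"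
  proof (rule eq_matI)
    fix i j assume "i < dim_row (B * Q)" "j < dim_col (B * Q)"
    then have ij: "i < ?N" "j < ?N"
      using Q by (auto simp: B_def)
    let ?j = "if j < n then j else 2 * n + m - Suc j"
    have "(B * Q) $$ (i, j) = (\<Sum>l<?N. A i l * Q $$ (l, j))"
      using ij Q by (auto simp: scalar_prod_def B_def lessThan_atLeast0)
    also have "\<dots> = (\<Sum>l<?N. if l = ?j then A i l else 0)"
      using ij by (intro sum.cong) (auto simp: Q_index)
    also have "\<dots> = A i ?j"
      using ij by (subst sum.delta) auto
    finally show "mat ?N ?N (\<lambda>(i, j). A i (if j < n then j else 2 * n + m - Suc j)) $$ (i, j)
        = (B * Q) $$ (i, j)"
      using ij by simp
  qed (use Q in \<open>auto simp: B_def\<close>)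
  moreover have "det Q = (\<Prod>j<m. (- 1) ^ j)"
    using J unfolding Q_def
    by (subst det_four_block_mat_lower_left_zero[of _ n _ m]) (simp_all add: J_def det_exchange_mat)
  moreover have "det (B * Q) = det B * det Q"
    using Q by (intro det_mult[of _ ?N]) (auto simp: B_def)
  ultimately show ?thesis
    by (simp add: B_def)
qed

text \<open>The factors \<open>L\<close> and \<open>C\<close> in the proof undo the row and column operations that produce the
  block triangular matrix \<open>B\<close>.\<close>

lemma det_symmetrize:
  fixes X Y :: "nat \<Rightarrow> int \<Rightarrow> 'a::idom" and E F :: "nat \<Rightarrow> int"
  assumes neg: "\<And>i e. i < n \<Longrightarrow> Y i e = X i (- e)" "\<And>e. Y n e = 1"
    and sel: "\<And>j. j < n \<Longrightarrow> \<sigma> j \<le> n \<and> F (\<sigma> j) = - E j"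
  shows "det (mat (n + Suc n) (n + Suc n) (\<lambda>(i, j).
      (if i < n then X i else Y (i - n)) (if j < n then E j else F (j - n))))
    = det (mat n n (\<lambda>(i, j). X i (E j) - Y i (E j)))
      * det (mat (Suc n) (Suc n) (\<lambda>(i, j). if i < n then X i (F j) + Y i (F j) else 1))"
proof -
  let ?m = "Suc n"
  define A where "A = mat n n (\<lambda>(i, j). X i (E j) - Y i (E j))"
  define U where "U = mat n ?m (\<lambda>(i, j). X i (F j))"
  define S where "S = mat ?m ?m (\<lambda>(i, j). if i < n then X i (F j) + Y i (F j) else 1)"
  \<comment> \<open>Multiplying by \<open>L\<close> on the left subtracts row i of the first block
    from row i of the second. The last row of \<open>P\<close> is zero, as the row of the argument 1
    has no partner.\<close>
  define P :: "'a mat" where "P = mat ?m n (\<lambda>(i, j). - of_bool (i = j))"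
  \<comment> \<open>Multiplying by \<open>C\<close> on the right adds column
    \<open>\<sigma> j\<close> of the second block to column \<open>j\<close> of the first.\<close>
  define R :: "'a mat" where "R = mat ?m n (\<lambda>(i, j). of_bool (i = \<sigma> j))"
  define V where "V = mat ?m ?m (\<lambda>(i, j). Y i (F j))"
  define L where "L = four_block_mat (1\<^sub>m n) (0\<^sub>m n ?m) P (1\<^sub>m ?m)"
  define B where "B = four_block_mat A U (0\<^sub>m ?m n) S"
  define C where "C = four_block_mat (1\<^sub>m n) (0\<^sub>m n ?m) R (1\<^sub>m ?m)"
  note defs = A_def U_def S_def P_def R_def V_def
  have [simp]: "A \<in> carrier_mat n n" "U \<in> carrier_mat n ?m" "S \<in> carrier_mat ?m ?m"
    "P \<in> carrier_mat ?m n" "R \<in> carrier_mat ?m n" "V \<in> carrier_mat ?m ?m"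
    by (simp_all add: defs)
  have LBC: "L \<in> carrier_mat (n + ?m) (n + ?m)" "B \<in> carrier_mat (n + ?m) (n + ?m)"
      "C \<in> carrier_mat (n + ?m) (n + ?m)"
    unfolding L_def B_def C_def by (intro four_block_carrier_mat; simp)+
  have PM: "P * M = mat ?m k (\<lambda>(i, j). if i < n then - M $$ (i, j) else 0)"
    if "M \<in> carrier_mat n k" for M k
  proof (rule eq_matI)
    fix i j assume "i < dim_row (mat ?m k (\<lambda>(i, j). if i < n then - M $$ (i, j) else 0))"
      "j < dim_col (mat ?m k (\<lambda>(i, j). if i < n then - M $$ (i, j) else 0))"
    then have ij: "i < ?m" "j < k"
      by auto
    have "(P * M) $$ (i, j) = (\<Sum>l<n. - of_bool (i = l) * M $$ (l, j))"
      using ij that by (auto simp: scalar_prod_def P_def lessThan_atLeast0)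
    also have "\<dots> = (\<Sum>l<n. if l = i then - M $$ (l, j) else 0)"
      by (intro sum.cong) auto
    finally show "(P * M) $$ (i, j) = mat ?m k (\<lambda>(i, j). if i < n then - M $$ (i, j) else 0) $$ (i, j)"
      using ij by (simp add: sum.delta)
  qed (use that in \<open>auto simp: P_def\<close>)
  have MR: "M * R = mat k n (\<lambda>(i, j). M $$ (i, \<sigma> j))" if "M \<in> carrier_mat k ?m" for M k
  proof (rule eq_matI)
    fix i j assume "i < dim_row (mat k n (\<lambda>(i, j). M $$ (i, \<sigma> j)))"
      "j < dim_col (mat k n (\<lambda>(i, j). M $$ (i, \<sigma> j)))"
    then have ij: "i < k" "j < n"
      by auto
    have "(M * R) $$ (i, j) = (\<Sum>l<?m. M $$ (i, l) * of_bool (l = \<sigma> j))"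
      using ij that by (auto simp: scalar_prod_def R_def lessThan_atLeast0)
    also have "\<dots> = (\<Sum>l<?m. if l = \<sigma> j then M $$ (i, l) else 0)"
      by (intro sum.cong) auto
    also have "\<dots> = M $$ (i, \<sigma> j)"
      using ij sel[of j] by (subst sum.delta) auto
    finally show "(M * R) $$ (i, j) = mat k n (\<lambda>(i, j). M $$ (i, \<sigma> j)) $$ (i, j)"
      using ij by simp
  qed (use that in \<open>auto simp: R_def\<close>)
  have [simp]: "P * A \<in> carrier_mat ?m n"
    by (rule mult_carrier_mat[of _ _ n]) simp_all
  have "P * U + S = V"
    by (subst PM[of _ ?m]) (auto simp: defs neg less_Suc_eq intro!: eq_matI)
  then have "L * B = four_block_mat A U (P * A) V"
    unfolding L_def B_def
    by (subst mult_four_block_mat[of _ n n _ ?m _ ?m _ _ n _ ?m])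
      (simp_all add: left_mult_one_mat[of A n n] left_mult_one_mat[of U n ?m]
        left_mult_one_mat[of S ?m ?m] left_mult_zero_mat[of S ?m ?m]
        right_add_zero_mat[of "P * A" ?m n])
  also have "\<dots> * C = four_block_mat (A + U * R) U (P * A + V * R) V"
    unfolding C_def
    by (subst mult_four_block_mat[of _ n n _ ?m _ ?m _ _ n _ ?m])
      (simp_all add: right_mult_one_mat[of A n n] right_mult_one_mat[of U n ?m]
        right_mult_one_mat[of "P * A" ?m n] right_mult_one_mat[of V ?m ?m]
        right_mult_zero_mat[of A n n] right_mult_zero_mat[of "P * A" ?m n])
  \<comment> \<open>As \<open>F (\<sigma> j) = - E j\<close>, the added entry is
    \<open>X i (- E j) = Y i (E j)\<close>, which cancels the subtracted term of
    \<open>A\<close>.\<close>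
  also have "A + U * R = mat n n (\<lambda>(i, j). X i (E j))"
    using sel by (subst MR[of _ n]) (auto simp: defs neg less_Suc_eq_le intro!: eq_matI)
  \<comment> \<open>For \<open>i < n\<close> the added entry \<open>Y i (- E j) = X i (E j)\<close>
    cancels \<open>- X i (E j)\<close>; in the last row \<open>P * A\<close> vanishes and
    \<open>Y n\<close> is constantly 1.\<close>
  also have "P * A + V * R = mat ?m n (\<lambda>(i, j). Y i (E j))"
    using sel by (subst MR[of _ ?m], simp, subst PM[of _ n])
      (auto simp: defs neg less_Suc_eq_le not_less intro!: eq_matI dest!: le_antisym)
  also have "four_block_mat (mat n n (\<lambda>(i, j). X i (E j))) U (mat ?m n (\<lambda>(i, j). Y i (E j))) V
      = mat (n + ?m) (n + ?m) (\<lambda>(i, j).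
      (if i < n then X i else Y (i - n)) (if j < n then E j else F (j - n)))"
    by (rule eq_matI) (auto simp: defs)
  finally have "det (mat (n + ?m) (n + ?m) (\<lambda>(i, j).
      (if i < n then X i else Y (i - n)) (if j < n then E j else F (j - n)))) = det (L * B * C)"
    by simp
  also have "\<dots> = det L * det B * det C"
    using LBC by (simp only: det_mult[of _ "n + ?m"] mult_carrier_mat[of _ _ "n + ?m"])
  also have "det L = 1"
    unfolding L_def by (subst det_four_block_mat_upper_right_zero[of _ n _ ?m]) auto
  also have "det C = 1"
    unfolding C_def by (subst det_four_block_mat_upper_right_zero[of _ n _ ?m]) auto
  also have "det B = det A * det S"
    unfolding B_def by (subst det_four_block_mat_lower_left_zero[of _ n _ ?m]) auto
  finally show ?thesis
    by (simp add: A_def S_def)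
qed

section \<open>Factorisation of the Vandermonde product\<close>

lemma prod_lessThan_add:
  fixes f :: "nat \<Rightarrow> 'a::comm_monoid_mult"
  shows "(\<Prod>i<n + m. f i) = (\<Prod>i<n. f i) * (\<Prod>i<m. f (n + i))"
  by (induction m) (simp_all add: mult_ac)

lemma prod_pairs_add:
  fixes g :: "nat \<Rightarrow> nat \<Rightarrow> 'a::comm_monoid_mult"
  shows "(\<Prod>j<n + m. \<Prod>i<j. g i j) =
    (\<Prod>j<n. \<Prod>i<j. g i j) * (\<Prod>j<m. \<Prod>i<j. g (n + i) (n + j)) * (\<Prod>j<m. \<Prod>i<n. g i (n + j))"
  by (simp add: prod_lessThan_add prod.distrib mult_ac)

text \<open>Off the diagonal, each pair of indices occurs in both orders. This brings the mixed
  differences \<open>x i - inverse (x j)\<close> and \<open>x j - inverse (x i)\<close>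
  together.\<close>

lemma prod_square_pairs:
  fixes g :: "nat \<Rightarrow> nat \<Rightarrow> 'a::comm_monoid_mult"
  shows "(\<Prod>j<n. \<Prod>i<n. g i j) = (\<Prod>j<n. \<Prod>i<j. g i j * g j i) * (\<Prod>i<n. g i i)"
  by (induction n) (simp_all add: prod.distrib mult_ac)

text \<open>These are all the differences between one of a, 1/a and one of b, 1/b, up to sign. Each
  side reduces to (a - b)(ab - 1)/(ab), squared and negated; the square supplies one factor to each
  of the two orthogonal denominators.\<close>

lemma four_differences:
  fixes a b :: "'a::field"
  assumes "a \<noteq> 0" "b \<noteq> 0"
  shows "(a - b) * (inverse a - inverse b) * ((a - inverse b) * (b - inverse a))
    = - 1 * ((a + inverse a - b - inverse b) * (a + inverse a - b - inverse b))"
proof -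
  have "a + inverse a - b - inverse b = (a - b) * (a * b - 1) / (a * b)"
    using assms by (simp add: field_simps)
  moreover have "inverse a - inverse b = - ((a - b) / (a * b))" "a - inverse b = (a * b - 1) / b"
    "b - inverse a = (a * b - 1) / a"
    using assms by (simp_all add: field_simps)
  ultimately show ?thesis
    using assms by (simp add: mult_ac del: minus_diff_eq)
qed

text \<open>Here \<open>a\<close> is a square root of a variable x, and the left side collects the
  differences among x, 1/x and 1. The right side supplies the prefactor of the identities, the extra
  factor of the odd orthogonal denominator, and the factor of the even one that pairs x with
  1.\<close>

lemma four_differences_diag:
  fixes a :: "'a::field"
  assumes "a \<noteq> 0"
  shows "(a\<^sup>2 - inverse (a\<^sup>2)) * (a\<^sup>2 - 1) * (inverse (a\<^sup>2) - 1)
    = - 1 * (a + inverse a) * (a - inverse a) * (a\<^sup>2 + inverse (a\<^sup>2) - 1 - 1)"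
proof -
  have "(a\<^sup>2 - 1) * (inverse (a\<^sup>2) - 1) = - (a\<^sup>2 + inverse (a\<^sup>2) - 1 - 1)"
    using assms by (simp add: algebra_simps)
  moreover have "a\<^sup>2 - inverse (a\<^sup>2) = (a + inverse a) * (a - inverse a)"
    by (simp add: power2_eq_square algebra_simps)
  ultimately show ?thesis
    by (simp only: mult.assoc mult_minus_left mult_minus_right mult_1_left)
qed

text \<open>Every pair \<open>i < j < n\<close> and every single \<open>i < n\<close> contributes
  one factor -1, in total n(n+1)/2 of them. This is the sign of reversing n + 1 columns.\<close>

lemma vandermonde_inverse_pairs:
  fixes ts :: "'a::field list"
  defines "n \<equiv> length ts" and "t \<equiv> \<lambda>i. (ts @ [1]) ! i"
  defines "y \<equiv> \<lambda>i. if i < n then (t i)\<^sup>2 else inverse ((t (i - n))\<^sup>2)"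
  assumes nz: "0 \<notin> set ts"
  shows "(\<Prod>j<n + Suc n. \<Prod>i<j. y i - y j) =
    (\<Prod>j<Suc n. (- 1) ^ j) * (\<Prod>i<n. ts ! i + inverse (ts ! i))
      * ((\<Prod>i<n. ts ! i - inverse (ts ! i)) * orth_denom ts) * orth_denom (ts @ [1])"
proof -
  define x where "x i = (t i)\<^sup>2" for i
  define d where "d i j = x i + inverse (x i) - x j - inverse (x j)" for i j
  have ti: "t i = ts ! i" "t i \<noteq> 0" if "i < n" for i
    using that nz by (auto simp: t_def n_def nth_append in_set_conv_nth)
  \<comment> \<open>The argument 1 is treated as the inverse of \<open>x n = 1\<close>, so that the
    second block of arguments consists of n + 1 inverses.\<close>
  have tn: "t n = 1"
    by (simp add: t_def n_def)
  have x: "x i \<noteq> 0" if "i < n" for i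
    using ti that by (simp add: x_def)
  have D: "orth_denom ts = (\<Prod>j<n. \<Prod>i<j. d i j)"
    unfolding orth_denom_def n_def[symmetric]
    by (intro prod.cong) (auto simp: d_def x_def ti)
  have "orth_denom (ts @ [1]) = (\<Prod>j<Suc n. \<Prod>i<j. d i j)"
    by (simp add: orth_denom_def d_def x_def t_def n_def del: prod.lessThan_Suc)
  then have D1: "orth_denom (ts @ [1]) = (\<Prod>j<n. \<Prod>i<j. d i j) * (\<Prod>i<n. d i n)"
    by simp
  have diag: "(x i - inverse (x i)) * (x i - 1) * (inverse (x i) - 1)
      = - 1 * (ts ! i + inverse (ts ! i)) * (ts ! i - inverse (ts ! i)) * d i n" if "i < n" for i
    using four_differences_diag[of "ts ! i"] ti[OF that]
    by (simp add: d_def x_def tn)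
  have "(\<Prod>j<n + Suc n. \<Prod>i<j. y i - y j) =
      (\<Prod>j<n. \<Prod>i<j. x i - x j) * (\<Prod>j<Suc n. \<Prod>i<j. inverse (x i) - inverse (x j))
      * (\<Prod>j<Suc n. \<Prod>i<n. x i - inverse (x j))"
    unfolding prod_pairs_add by (intro arg_cong2[where f = "(*)"] prod.cong) (auto simp: y_def x_def)
  \<comment> \<open>The mixed product runs over an n by n + 1 rectangle. Its square part splits by
    \<open>prod_square_pairs\<close>; its last column \<open>x i - 1\<close> and the last factors
    \<open>inverse (x i) - 1\<close> of the second block join the diagonal.\<close>
  also have "\<dots> = (\<Prod>j<n. \<Prod>i<j. (x i - x j) * (inverse (x i) - inverse (x j))
        * ((x i - inverse (x j)) * (x j - inverse (x i))))
      * (\<Prod>i<n. (x i - inverse (x i)) * (x i - 1) * (inverse (x i) - 1))"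
    by (simp add: prod_square_pairs prod.distrib tn x_def mult_ac)
  also have "\<dots> = (\<Prod>j<n. \<Prod>i<j. - 1 * (d i j * d i j))
      * (\<Prod>i<n. - 1 * (ts ! i + inverse (ts ! i)) * (ts ! i - inverse (ts ! i)) * d i n)"
    using diag unfolding d_def
    by (intro arg_cong2[OF prod.cong[OF refl prod.cong[OF refl four_differences]] prod.cong[OF refl],
          where f = "(*)"])
      (auto simp: x)
  also have "\<dots> = (\<Prod>j<Suc n. (- 1) ^ j) * (\<Prod>i<n. ts ! i + inverse (ts ! i))
      * ((\<Prod>i<n. ts ! i - inverse (ts ! i)) * orth_denom ts) * orth_denom (ts @ [1])"
    unfolding D D1 prod.distrib by (simp add: mult_ac)
  finally show ?thesis .
qed

section \<open>The Schur polynomial as a product of two orthogonal quotients\<close>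

text \<open>The column with exponent \<open>- E j\<close> is column \<open>\<sigma> j\<close> of the even block. The exponents of the Schur
  numerator list the even block in reverse order, and are doubled since \<open>ts\<close> holds square roots.\<close>

lemma schur_inverse_pairs:
  fixes ts :: "'a::field list" and E F :: "nat \<Rightarrow> int"
  defines "n \<equiv> length ts"
  assumes nz: "0 \<notin> set ts" "\<And>t. t \<in> set ts \<Longrightarrow> t + inverse t \<noteq> 0"
    and sel: "\<And>j. j < n \<Longrightarrow> \<sigma> j \<le> n \<and> F (\<sigma> j) = - E j"
    and \<mu>: "\<And>j. j < n + Suc n \<Longrightarrow> 2 * \<lfloor>\<mu> ! j + of_nat (n + Suc n - Suc j)\<rfloor>
      = c + (if j < n then E j else F (n + n - j))"
  shows "2 * (\<Prod>i<n. ts ! i + inverse (ts ! i))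
      * schur \<mu> (map (\<lambda>t. t\<^sup>2) ts @ map (\<lambda>t. inverse (t\<^sup>2)) ts @ [1])
    = det (mat n n (\<lambda>(i, j). (ts ! i) powi E j - inverse (ts ! i) powi E j))
        / ((\<Prod>i<n. ts ! i - inverse (ts ! i)) * orth_denom ts)
      * (det (mat (Suc n) (Suc n)
            (\<lambda>(i, j). ((ts @ [1]) ! i) powi F j + inverse ((ts @ [1]) ! i) powi F j))
        / orth_denom (ts @ [1]))"
proof -
  let ?N = "n + Suc n" and ?sgn = "\<Prod>j<Suc n. (- 1) ^ j :: 'a"
  define t where "t i = (ts @ [1]) ! i" for i
  \<comment> \<open>\<open>T i\<close> is a square root of the i-th argument, so the doubled
    exponents become its integer powers.\<close>
  define T where "T i = (if i < n then t i else inverse (t (i - n)))" for i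
  define H where "H j = (if j < n then E j else F (j - n))" for j
  define ys where "ys = map (\<lambda>t. t\<^sup>2) ts @ map (\<lambda>t. inverse (t\<^sup>2)) ts @ [1]"
  define y where "y i = (if i < n then (t i)\<^sup>2 else inverse ((t (i - n))\<^sup>2))" for i
  define A where "A = det (mat n n (\<lambda>(i, j). t i powi E j - inverse (t i) powi E j))"
  define S where "S = det (mat (Suc n) (Suc n) (\<lambda>(i, j). t i powi F j + inverse (t i) powi F j))"
  define M where "M = det (mat ?N ?N (\<lambda>(i, j). ys ! i powi \<lfloor>\<mu> ! j + of_nat (?N - Suc j)\<rfloor>))"
  have t: "t i = ts ! i" "t i \<noteq> 0" if "i < n" for i
    using that nz by (auto simp: t_def n_def nth_append in_set_conv_nth)
  have tn: "t n = 1"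
    by (simp add: t_def n_def)
  have t0: "t i \<noteq> 0" if "i \<le> n" for i
    using t tn that by (cases "i = n") auto
  have ys: "ys ! i = y i" "y i = (T i)\<^sup>2" "T i \<noteq> 0" if "i < ?N" for i
  proof -
    show "T i \<noteq> 0"
      using that t0 by (auto simp: T_def)
    show "y i = (T i)\<^sup>2"
      by (simp add: y_def T_def power_inverse)
    show "ys ! i = y i"
      using that tn t(1)
      by (cases "i = n + n") (auto simp: ys_def y_def n_def nth_append)
  qed
  have M: "M = ?sgn * (A * det (mat (Suc n) (Suc n)
      (\<lambda>(i, j). if i < n then t i powi F j + inverse (t i) powi F j else 1)))"
  proof -
    \<comment> \<open>The common shift \<open>c\<close> of the doubled exponents turns into a factor
      of each row.\<close>
    have "M = det (mat ?N ?N (\<lambda>(i, j). T i powi c * T i powi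
        H (if j < n then j else 2 * n + Suc n - Suc j)))"
      unfolding M_def
    proof (intro arg_cong[where f = det] cong_mat refl)
      fix i j assume ij: "i < ?N" "j < ?N"
      have "y i powi \<lfloor>\<mu> ! j + of_nat (?N - Suc j)\<rfloor> = T i powi (2 * \<lfloor>\<mu> ! j + of_nat (?N - Suc j)\<rfloor>)"
        using ys[OF ij(1)] by (simp only: power_int_mult power_int_numeral)
      also have "\<dots> = T i powi c * T i powi H (if j < n then j else 2 * n + Suc n - Suc j)"
        unfolding \<mu>[OF ij(2)] using ys[OF ij(1)] ij
        by (auto simp: power_int_add H_def mult_2 intro!: arg_cong[where f = F])
      finally show "(case (i, j) of (i, j) \<Rightarrow> ys ! i powi \<lfloor>\<mu> ! j + of_nat (?N - Suc j)\<rfloor>)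
          = (case (i, j) of (i, j) \<Rightarrow> T i powi c * T i powi H (if j < n then j else 2 * n + Suc n - Suc j))"
        using ys[OF ij(1)] by simp
    qed
    also have "\<dots> = (\<Prod>i<?N. T i powi c) * (?sgn * det (mat ?N ?N (\<lambda>(i, j). T i powi H j)))"
      by (simp only: det_row_scale det_reverse_last_cols[of n "Suc n" "\<lambda>i j. T i powi H j"])
    also have "(\<Prod>i<?N. T i powi c) = (\<Prod>i<n. t i powi c * inverse (t i) powi c)"
      by (simp add: prod_lessThan_add prod.distrib T_def tn)
    also have "\<dots> = 1"
      by (intro prod.neutral) (auto simp: t(2) power_int_inverse)
    also have "mat ?N ?N (\<lambda>(i, j). T i powi H j) = mat ?N ?N (\<lambda>(i, j).
        (if i < n then (\<lambda>e. t i powi e) else (\<lambda>e. inverse (t (i - n)) powi e))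
        (if j < n then E j else F (j - n)))"
      by (intro cong_mat refl) (auto simp: T_def H_def)
    also have "det \<dots> = A * det (mat (Suc n) (Suc n)
        (\<lambda>(i, j). if i < n then t i powi F j + inverse (t i) powi F j else 1))"
      unfolding A_def
      by (rule det_symmetrize[where \<sigma> = \<sigma>]) (use sel tn in \<open>auto simp: power_int_inverse power_int_minus\<close>)
    finally show ?thesis
      by simp
  qed
  \<comment> \<open>The row of the argument 1 in \<open>S\<close> has entries 1 + 1 = 2, against 1
    in the block triangular form. This is the source of the factor 2 in the identities.\<close>
  have "S = det (mat (Suc n) (Suc n) (\<lambda>(i, j). (if i < n then 1 else 2) *
      (if i < n then t i powi F j + inverse (t i) powi F j else 1)))"
    unfolding S_def by (intro arg_cong[where f = det] cong_mat refl) (auto simp: less_Suc_eq tn)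
  also have "\<dots> = 2 * det (mat (Suc n) (Suc n)
      (\<lambda>(i, j). if i < n then t i powi F j + inverse (t i) powi F j else 1))"
    by (simp add: det_row_scale)
  finally have MS: "2 * M = ?sgn * (A * S)"
    by (simp add: M mult_ac)
  have len: "length ys = ?N"
    by (simp add: ys_def n_def)
  have "schur \<mu> ys = M / (\<Prod>j<?N. \<Prod>i<j. y i - y j)"
    unfolding schur_def len Let_def M_def
    by (intro arg_cong2[where f = "(/)"] prod.cong refl) (simp add: ys(1))
  also have "(\<Prod>j<?N. \<Prod>i<j. y i - y j) = ?sgn * (\<Prod>i<n. ts ! i + inverse (ts ! i))
      * ((\<Prod>i<n. ts ! i - inverse (ts ! i)) * orth_denom ts) * orth_denom (ts @ [1])"
    unfolding y_def t_def n_def by (rule vandermonde_inverse_pairs) (use nz in auto)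
  finally have schur: "schur \<mu> ys = M / \<dots>" .
  \<comment> \<open>If \<open>q\<close> or \<open>r\<close> vanishes, both sides are 0 by the
    convention for division by zero; otherwise the common factors cancel.\<close>
  have cancel: "2 * p * (m / (s * p * q * r)) = a / q * (b / r)"
    if "p \<noteq> 0" "s \<noteq> 0" "2 * m = s * (a * b)" for p m s q r a b :: 'a
  proof -
    have "2 * p * (m / (s * p * q * r)) = (2 * m) * p / (s * p * q * r)"
      by simp
    also have "\<dots> = a * b / (q * r)"
      unfolding that(3) using that(1,2) by simp
    finally show ?thesis
      by simp
  qed
  have "(\<Prod>i<n. ts ! i + inverse (ts ! i)) \<noteq> 0"
    using nz by (simp add: n_def)
  moreover have "?sgn \<noteq> 0"
    by simp
  ultimately have "2 * (\<Prod>i<n. ts ! i + inverse (ts ! i)) * schur \<mu> ys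
      = A / ((\<Prod>i<n. ts ! i - inverse (ts ! i)) * orth_denom ts) * (S / orth_denom (ts @ [1]))"
    unfolding schur by (rule cancel[OF _ _ MS])
  moreover have "A = det (mat n n (\<lambda>(i, j). (ts ! i) powi E j - inverse (ts ! i) powi E j))"
    unfolding A_def by (intro arg_cong[where f = det] cong_mat refl) (simp add: t(1))
  ultimately show ?thesis
    by (simp only: S_def t_def ys_def)
qed

section \<open>Doubled exponents: orthogonal characters, floors and parity\<close>

lemma half_power_eq:
  assumes "2 * a = of_int m"
  shows "half_power t a = t powi m"
  by (simp add: half_power_def assms)

lemma so_odd_eq:
  assumes "N = length ts"
    and "\<And>j. j < N \<Longrightarrow> 2 * (\<mu> ! j + of_nat (N - Suc j) + 1/2) = of_int (E j)"
  shows "so_odd \<mu> ts = det (mat N N (\<lambda>(i, j). (ts ! i) powi E j - inverse (ts ! i) powi E j))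
    / ((\<Prod>i<N. ts ! i - inverse (ts ! i)) * orth_denom ts)"
  unfolding so_odd_def Let_def assms(1)[symmetric]
  by (intro arg_cong2[where f = "(/)"] arg_cong[where f = det] cong_mat refl)
    (simp only: half_power_eq[OF assms(2)] prod.case)

text \<open>The entries are invariant under negating the exponent, so \<open>F\<close> may hold
  either sign of each doubled exponent. The pairing \<open>F (\<sigma> j) = - E j\<close> asks for
  negative ones.\<close>

lemma o_even_eq:
  assumes "N = length ts"
    and "\<And>j. j < N \<Longrightarrow> 2 * (\<mu> ! j + of_nat (N - Suc j)) \<in> {of_int (F j), of_int (- F j)}"
  shows "o_even \<mu> ts = det (mat N N (\<lambda>(i, j). (ts ! i) powi F j + inverse (ts ! i) powi F j))
    / ((1 + of_bool (\<mu> ! (N - 1) = 0)) * orth_denom ts)"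
proof -
  have "half_power t (\<mu> ! j + of_nat (N - Suc j)) + half_power (inverse t) (\<mu> ! j + of_nat (N - Suc j))
      = t powi F j + inverse t powi F j" if "j < N" for t :: 'a and j
  proof (cases "2 * (\<mu> ! j + of_nat (N - Suc j)) = of_int (F j)")
    case True
    then show ?thesis
      by (simp only: half_power_eq)
  next
    case False
    then have "2 * (\<mu> ! j + of_nat (N - Suc j)) = of_int (- F j)"
      using assms(2)[OF that] by blast
    then show ?thesis
      by (simp only: half_power_eq) (simp add: power_int_minus power_int_inverse)
  qed
  then show ?thesis
    unfolding o_even_def Let_def assms(1)[symmetric]
    by (intro arg_cong2[where f = "(/)"] arg_cong[where f = det] cong_mat refl) simp
qed

text \<open>Removes the floor in \<open>schur\<close>: its exponents are genuine integers because
  their doubles are even.\<close>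

lemma double_floor:
  fixes x :: rat
  assumes "2 * x = of_int m" "even m"
  shows "2 * \<lfloor>x\<rfloor> = m"
proof -
  obtain l where "m = 2 * l"
    using assms(2) by blast
  then have "x = of_int l"
    using assms(1) by simp
  then show ?thesis
    using \<open>m = 2 * l\<close> by simp
qed

lemma double_half_integer:
  assumes "half_integer r"
  shows "2 * r = of_int \<lfloor>2 * r\<rfloor>" "odd \<lfloor>2 * r\<rfloor>"
proof -
  obtain m where "odd m" "2 * r = of_int m"
    using assms by (auto simp: half_integer_def)
  then show "2 * r = of_int \<lfloor>2 * r\<rfloor>" "odd \<lfloor>2 * r\<rfloor>"
    by simp_all
qed

lemma double_Ints:
  fixes r :: rat
  assumes "r \<in> \<int>"
  shows "2 * r = of_int \<lfloor>2 * r\<rfloor>" "even \<lfloor>2 * r\<rfloor>"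
proof -
  obtain m where r: "r = of_int m"
    using assms by (rule Ints_cases)
  then have "\<lfloor>2 * r\<rfloor> = 2 * m"
    by (metis floor_of_int of_int_mult of_int_numeral)
  then show "2 * r = of_int \<lfloor>2 * r\<rfloor>" "even \<lfloor>2 * r\<rfloor>"
    by (simp_all add: r)
qed

section \<open>Choice of exponents for the two factorisations\<close>

theorem theorem3:
  fixes n :: nat and lam :: "nat \<Rightarrow> rat" and k :: rat
  assumes "n > 0"
    and "is_partition (map lam [0..<Suc n]) \<and> k \<in> \<int> \<or>
         is_half_partition (map lam [0..<Suc n]) \<and> half_integer k"
    and "k \<ge> lam 0"
  shows
    "2 * (\<Prod>i=1..n. sqrt_indet i + inverse (sqrt_indet i)) *
       schur (map (\<lambda>i. k + lam i) [1..<Suc n] @ map (\<lambda>i. k - lam i) (rev [0..<Suc n]))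
             (map indet [1..<Suc n] @ map (\<lambda>i. inverse (indet i)) [1..<Suc n] @ [1])
     = so_odd (map lam [1..<Suc n]) (map sqrt_indet [1..<Suc n]) *
       o_even (map (\<lambda>i. lam i + 1/2) [0..<Suc n]) (map sqrt_indet [1..<Suc n] @ [1])
     \<and> (\<forall>\<epsilon>\<in>{1, -1}.
       2 * (\<Prod>i=1..n. sqrt_indet i + inverse (sqrt_indet i)) *
       schur (map (\<lambda>i. k + lam i) [0..<n] @ [k + \<epsilon> * lam n] @ map (\<lambda>i. k - lam i) (rev [0..<n]))
             (map indet [1..<Suc n] @ map (\<lambda>i. inverse (indet i)) [1..<Suc n] @ [1])
     = (1 + of_bool (lam n = 0)) *
       so_odd (map (\<lambda>i. lam i + 1/2) [0..<n]) (map sqrt_indet [1..<Suc n]) *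
       o_even (map lam [0..<Suc n]) (map sqrt_indet [1..<Suc n] @ [1]))"
proof -
  define ts where "ts = map sqrt_indet [1..<Suc n]"
  define L where "L i = \<lfloor>2 * lam i\<rfloor>" for i
  define K where "K = \<lfloor>2 * k\<rfloor>"
  have n: "length ts = n"
    by (simp add: ts_def)
  have prod: "(\<Prod>i=1..n. sqrt_indet i + inverse (sqrt_indet i)) = (\<Prod>i<n. ts ! i + inverse (ts ! i))"
    by (simp add: ts_def prod.atLeast1_atMost_eq del: upt_Suc)
  have args: "map indet [1..<Suc n] @ map (\<lambda>i. inverse (indet i)) [1..<Suc n] @ [1]
      = map (\<lambda>t. t\<^sup>2) ts @ map (\<lambda>t. inverse (t\<^sup>2)) ts @ [1]"
    by (simp add: ts_def indet_def del: upt_Suc)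
  have sqrt: "sqrt_indet i \<noteq> 0" "sqrt_indet i + inverse (sqrt_indet i) \<noteq> 0" for i
  proof -
    show 0: "sqrt_indet i \<noteq> 0"
      using indet_nonzero[of i] by (auto simp: indet_def)
    show "sqrt_indet i + inverse (sqrt_indet i) \<noteq> 0"
    proof
      assume "sqrt_indet i + inverse (sqrt_indet i) = 0"
      then have "sqrt_indet i * (sqrt_indet i + inverse (sqrt_indet i)) = 0"
        by simp
      then have "indet i = - 1"
        using 0 by (simp add: indet_def power2_eq_square distrib_left eq_neg_iff_add_eq_0)
      then show False
        using indet_mult_neq_1[of i i] by simp
    qed
  qed
  have nz: "0 \<notin> set ts" "\<And>t. t \<in> set ts \<Longrightarrow> t + inverse t \<noteq> 0"
    using sqrt by (auto simp: ts_def simp del: upt_Suc)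
  \<comment> \<open>Merges the partition and half-partition cases: from here on the exponents are
    expressed through the integers \<open>L i\<close> and \<open>K\<close>, which have equal
    parity.\<close>
  have LK: "2 * lam i = of_int (L i)" "2 * k = of_int K" "even (K + L i)" "lam i \<ge> 0"
    if "i \<le> n" for i
  proof -
    have mem: "lam i \<in> set (map lam [0..<Suc n])"
      using that by (auto simp del: upt_Suc)
    from assms(2) have "2 * lam i = of_int (L i) \<and> 2 * k = of_int K \<and> even (K + L i) \<and> lam i \<ge> 0"
    proof
      assume a: "is_partition (map lam [0..<Suc n]) \<and> k \<in> \<int>"
      then have "lam i \<in> \<nat>"
        using mem unfolding is_partition_def by blast
      then have "lam i \<in> \<int>" "lam i \<ge> 0"
        using Nats_subset_Ints by (auto simp: Nats_def)
      then show ?thesis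
        using a double_Ints[of "lam i"] double_Ints[of k] by (simp add: L_def K_def)
    next
      assume a: "is_half_partition (map lam [0..<Suc n]) \<and> half_integer k"
      then have "half_integer (lam i)" "lam i > 0"
        using mem unfolding is_half_partition_def by blast+
      then show ?thesis
        using a double_half_integer[of "lam i"] double_half_integer[of k]
        by (simp add: L_def K_def)
    qed
    then show "2 * lam i = of_int (L i)" "2 * k = of_int K" "even (K + L i)" "lam i \<ge> 0"
      by auto
  qed
  have L_half: "lam i = of_int (L i) / 2" if "i \<le> n" for i
    using LK(1)[OF that] by simp
  have K_half: "k = of_int K / 2"
    using LK(2)[of 0] by simp
  show ?thesis
  proof (intro conjI ballI)
    \<comment> \<open>\<open>E\<close> holds the doubled exponents of the odd character and
      \<open>F\<close> the negated doubled exponents of the even one. Since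
      \<open>F (Suc j) = - E j\<close>, the column left unpaired is that of
      \<open>lam 0\<close>.\<close>
    define E where "E j = L (Suc j) + 2 * int (n - Suc j) + 1" for j
    define F where "F j = - (L j + 1 + 2 * int (n - j))" for j
    let ?\<mu> = "map (\<lambda>i. k + lam i) [1..<Suc n] @ map (\<lambda>i. k - lam i) (rev [0..<Suc n])"
    have \<mu>: "?\<mu> ! j = (if j < n then k + lam (Suc j) else k - lam (n + n - j))" if "j < n + Suc n" for j
      using that by (auto simp: nth_append rev_nth rev_map[symmetric] mult_2 simp del: upt_Suc
          intro!: arg_cong[where f = lam])
    have "2 * (\<Prod>i<n. ts ! i + inverse (ts ! i))
        * schur ?\<mu> (map (\<lambda>t. t\<^sup>2) ts @ map (\<lambda>t. inverse (t\<^sup>2)) ts @ [1])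
      = det (mat n n (\<lambda>(i, j). (ts ! i) powi E j - inverse (ts ! i) powi E j))
          / ((\<Prod>i<n. ts ! i - inverse (ts ! i)) * orth_denom ts)
        * (det (mat (Suc n) (Suc n)
              (\<lambda>(i, j). ((ts @ [1]) ! i) powi F j + inverse ((ts @ [1]) ! i) powi F j))
          / orth_denom (ts @ [1]))"
      unfolding n[symmetric]
    \<comment> \<open>\<open>c\<close> is the centre about which the paired doubled Schur exponents
      are symmetric.\<close>
    proof (rule schur_inverse_pairs[where \<sigma> = Suc and c = "K + 2 * int n + 1"], unfold n)
      fix j assume j: "j < n + Suc n"
      show "2 * \<lfloor>?\<mu> ! j + of_nat (n + Suc n - Suc j)\<rfloor>
          = (K + 2 * int n + 1) + (if j < n then E j else F (n + n - j))"
        unfolding \<mu>[OF j] using j LK(3)[of "Suc j"] LK(3)[of "n + n - j"]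
        by (intro double_floor)
          (auto simp: E_def F_def L_half K_half of_nat_diff field_simps)
    qed (use nz in \<open>auto simp: E_def F_def\<close>)
    also have "\<dots> = so_odd (map lam [1..<Suc n]) ts
        * o_even (map (\<lambda>i. lam i + 1/2) [0..<Suc n]) (ts @ [1])"
    proof (rule arg_cong2[where f = "(*)"])
      show "det (mat n n (\<lambda>(i, j). (ts ! i) powi E j - inverse (ts ! i) powi E j))
          / ((\<Prod>i<n. ts ! i - inverse (ts ! i)) * orth_denom ts) = so_odd (map lam [1..<Suc n]) ts"
        by (rule so_odd_eq[symmetric]) (auto simp: n E_def L_half of_nat_diff simp del: upt_Suc)
      \<comment> \<open>Hence the Kronecker delta in the even character contributes nothing.\<close>
      have "lam n + 1/2 \<noteq> 0"
        using LK(4)[of n] by simp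
      moreover have "o_even (map (\<lambda>i. lam i + 1/2) [0..<Suc n]) (ts @ [1])
          = det (mat (Suc n) (Suc n)
              (\<lambda>(i, j). ((ts @ [1]) ! i) powi F j + inverse ((ts @ [1]) ! i) powi F j))
          / ((1 + of_bool (map (\<lambda>i. lam i + 1/2) [0..<Suc n] ! (Suc n - 1) = 0)) * orth_denom (ts @ [1]))"
        by (rule o_even_eq) (auto simp: n F_def L_half of_nat_diff less_Suc_eq_le simp del: upt_Suc)
      ultimately show "det (mat (Suc n) (Suc n)
              (\<lambda>(i, j). ((ts @ [1]) ! i) powi F j + inverse ((ts @ [1]) ! i) powi F j))
          / orth_denom (ts @ [1]) = o_even (map (\<lambda>i. lam i + 1/2) [0..<Suc n]) (ts @ [1])"
        by (simp del: upt_Suc)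
    qed
    finally show "2 * (\<Prod>i=1..n. sqrt_indet i + inverse (sqrt_indet i)) *
        schur ?\<mu> (map indet [1..<Suc n] @ map (\<lambda>i. inverse (indet i)) [1..<Suc n] @ [1])
      = so_odd (map lam [1..<Suc n]) (map sqrt_indet [1..<Suc n])
        * o_even (map (\<lambda>i. lam i + 1/2) [0..<Suc n]) (map sqrt_indet [1..<Suc n] @ [1])"
      unfolding prod args ts_def[symmetric] .
  next
    fix \<epsilon> :: rat
    assume "\<epsilon> \<in> {1, -1}"
    then obtain e :: int where e: "\<epsilon> = of_int e" "e = 1 \<or> e = - 1"
      by (metis empty_iff insert_iff of_int_1 of_int_minus)
    \<comment> \<open>Now \<open>F j = - E j\<close> for \<open>j < n\<close>, and the unpaired
      column is that of \<open>lam n\<close>. Its exponent can take either sign, which accounts for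
      the two choices of \<epsilon>.\<close>
    define E where "E j = L j + 2 * int (n - j)" for j
    define F where "F j = (if j < n then - (L j + 2 * int (n - j)) else e * L n)" for j
    let ?\<mu> = "map (\<lambda>i. k + lam i) [0..<n] @ [k + \<epsilon> * lam n] @ map (\<lambda>i. k - lam i) (rev [0..<n])"
    have \<mu>: "?\<mu> ! j = (if j < n then k + lam j else if j = n then k + \<epsilon> * lam n
        else k - lam (n + n - j))" if "j < n + Suc n" for j
      using that by (auto simp: nth_append nth_Cons' rev_nth rev_map[symmetric] mult_2
          intro!: arg_cong[where f = lam])
    have "2 * (\<Prod>i<n. ts ! i + inverse (ts ! i))
        * schur ?\<mu> (map (\<lambda>t. t\<^sup>2) ts @ map (\<lambda>t. inverse (t\<^sup>2)) ts @ [1])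
      = det (mat n n (\<lambda>(i, j). (ts ! i) powi E j - inverse (ts ! i) powi E j))
          / ((\<Prod>i<n. ts ! i - inverse (ts ! i)) * orth_denom ts)
        * (det (mat (Suc n) (Suc n)
              (\<lambda>(i, j). ((ts @ [1]) ! i) powi F j + inverse ((ts @ [1]) ! i) powi F j))
          / orth_denom (ts @ [1]))"
      unfolding n[symmetric]
    proof (rule schur_inverse_pairs[where \<sigma> = "\<lambda>j. j" and c = "K + 2 * int n"], unfold n)
      fix j assume j: "j < n + Suc n"
      consider "j < n" | "j = n" | "n < j" "j \<le> n + n"
        using j by linarith
      then show "2 * \<lfloor>?\<mu> ! j + of_nat (n + Suc n - Suc j)\<rfloor>
          = (K + 2 * int n) + (if j < n then E j else F (n + n - j))"
        unfolding \<mu>[OF j] using e(2) LK(3)[of j] LK(3)[of "n + n - j"]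
        by cases (intro double_floor; auto simp: E_def F_def e(1) L_half K_half of_nat_diff field_simps)+
    qed (use nz in \<open>auto simp: E_def F_def\<close>)
    also have "\<dots> = (1 + of_bool (lam n = 0)) * so_odd (map (\<lambda>i. lam i + 1/2) [0..<n]) ts
        * o_even (map lam [0..<Suc n]) (ts @ [1])"
    proof -
      have "so_odd (map (\<lambda>i. lam i + 1/2) [0..<n]) ts
          = det (mat n n (\<lambda>(i, j). (ts ! i) powi E j - inverse (ts ! i) powi E j))
          / ((\<Prod>i<n. ts ! i - inverse (ts ! i)) * orth_denom ts)"
        by (rule so_odd_eq) (auto simp: n E_def L_half of_nat_diff)
      moreover have "o_even (map lam [0..<Suc n]) (ts @ [1])
          = det (mat (Suc n) (Suc n)
              (\<lambda>(i, j). ((ts @ [1]) ! i) powi F j + inverse ((ts @ [1]) ! i) powi F j))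
          / ((1 + of_bool (map lam [0..<Suc n] ! (Suc n - 1) = 0)) * orth_denom (ts @ [1]))"
        using e(2)
        by (intro o_even_eq) (auto simp: n F_def L_half of_nat_diff less_Suc_eq_le simp del: upt_Suc)
      \<comment> \<open>The factor is 1 or 2, hence nonzero, and cancels the same factor in the
        denominator of the even character.\<close>
      moreover have "(1 + of_bool (lam n = 0) :: ratfun) \<noteq> 0"
        using two_ratfun_nonzero by simp
      ultimately show ?thesis
        by (simp del: upt_Suc)
    qed
    finally show "2 * (\<Prod>i=1..n. sqrt_indet i + inverse (sqrt_indet i)) *
        schur ?\<mu> (map indet [1..<Suc n] @ map (\<lambda>i. inverse (indet i)) [1..<Suc n] @ [1])
      = (1 + of_bool (lam n = 0)) * so_odd (map (\<lambda>i. lam i + 1/2) [0..<n]) (map sqrt_indet [1..<Suc n])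
        * o_even (map lam [0..<Suc n]) (map sqrt_indet [1..<Suc n] @ [1])"
      unfolding prod args ts_def[symmetric] .
  qed
qed

end
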